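(* Let $\widehat{\mathcal{L}}$ be the completed Witt Lie algebra and $\widehat{\mathcal{L}}_1=\{\sum_{j=1}^{\infty}a_jL_j\mid a_j\in\mathbb{C}\}\subset\widehat{\mathcal{L}}$. Then the automorphism group of $\widehat{\mathcal{L}}$ is $$\mathrm{Aut}\,\widehat{\mathcal{L}}=\{\exp^{\mathrm{ad}\,x}\exp^{a_0\,\mathrm{ad}\,L_0}\mid a_0\in\mathbb{C},\ x\in\widehat{\mathcal{L}}_1\}.$$
   Context: The completed Witt Lie algebra $\widehat{\mathcal{L}}$ is the complex vector space of all formal infinite sums $\sum_{i=-1}^{\infty}a_iL_i$ with $a_i\in\mathbb{C}$ (where $L_i$, $i\ge-1$, are symbols and two sums are equal iff all their coefficients agree), with Lie bracket $$\Big[\sum_{i=-1}^{\infty}a_iL_i,\sum_{i=-1}^{\infty}b_iL_i\Big]=\sum_{i=-1}^{\infty}\Big(\sum_{j=-1}^{i+1}(2j-i)a_{i-j}b_j\Big)L_i,$$ so that $[L_i,L_j]=(j-i)L_{i+j}$. $\mathrm{Aut}\,\widehat{\mathcal{L}}$ is the group of all ($\mathbb{C}$-linear, not assumed continuous) Lie algebra automorphisms. Here $\mathrm{ad}\,x(y)=[x,y]$. For $x\in\widehat{\mathcal{L}}_1$, $\exp^{\mathrm{ad}\,x}(y)=\sum_{k=0}^{\infty}\frac{1}{k!}(\mathrm{ad}\,x)^k(y)$ for $y\in\widehat{\mathcal{L}}$, which is well defined because each coefficient of the result involves only finitely many nonzero terms. For $a_0\in\mathbb{C}$, $\exp^{a_0\,\mathrm{ad}\,L_0}$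 is given by the same exponential series, interpreted coefficientwise: $\exp^{a_0\,\mathrm{ad}\,L_0}(\sum_i c_iL_i)=\sum_i e^{ia_0}c_iL_i$. *)

theory Defs
  imports Complex_Main "HOL-Algebra.Group"
begin

text \<open>
  A formal sum \<open>\<Sum>i\<ge>-1. a i L i\<close> is identified with its coefficient family, extended by zero
  to all integer indices below \<open>-1\<close>.
\<close>

typedef witt = "{a :: int \<Rightarrow> complex. \<forall>i < -1. a i = 0}"
  morphisms coeff Abs_witt
  by (rule exI[of _ "\<lambda>_. 0"]) simp

setup_lifting type_definition_witt

lemma witt_eqI: "(\<And>i. coeff x i = coeff y i) \<Longrightarrow> x = y"
  by (simp add: coeff_inject[symmetric] fun_eq_iff)

lemma coeff_below: "i < -1 \<Longrightarrow> coeff x i = 0"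
  using coeff[of x] by simp

instantiation witt :: ab_group_add
begin

lift_definition zero_witt :: witt is "\<lambda>_. 0" by simp

lift_definition plus_witt :: "witt \<Rightarrow> witt \<Rightarrow> witt" is "\<lambda>a b i. a i + b i" by simp

lift_definition uminus_witt :: "witt \<Rightarrow> witt" is "\<lambda>a i. - a i" by simp

lift_definition minus_witt :: "witt \<Rightarrow> witt \<Rightarrow> witt" is "\<lambda>a b i. a i - b i" by simp

instance
  by standard (transfer; simp add: fun_eq_iff algebra_simps)+

end

lift_definition scale_witt :: "complex \<Rightarrow> witt \<Rightarrow> witt"  (infixr "*\<^sub>C" 75)
  is "\<lambda>c a i. c * a i" by simp

interpretation witt: vector_space scale_witt
  by standard (transfer; simp add: fun_eq_iff algebra_simps)+

text \<open>The symbol \<open>L i\<close>; meaningful for \<open>i \<ge> -1\<close>, and zero otherwise.\<close>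

lift_definition L :: "int \<Rightarrow> witt" is "\<lambda>i j. if j = i \<and> -1 \<le> i then 1 else 0"
  by auto

lift_definition bracket :: "witt \<Rightarrow> witt \<Rightarrow> witt"
  is "\<lambda>a b i. \<Sum>j = -1..i + 1. of_int (2 * j - i) * a (i - j) * b j"
proof -
  fix a b :: "int \<Rightarrow> complex" and i :: int
  assume "i < -1"
  then consider "i = -2" | "i < -2" by linarith
  then show "(\<Sum>j = -1..i + 1. of_int (2 * j - i) * a (i - j) * b j) = 0"
    by cases simp_all
qed

abbreviation ad :: "witt \<Rightarrow> witt \<Rightarrow> witt" where
  "ad x \<equiv> bracket x"

definition L1 :: "witt set" where
  "L1 = {x. coeff x (-1) = 0 \<and> coeff x 0 = 0}"

text \<open>
  The operator exponential \<open>\<Sum>k. T^k / k!\<close>, summed coefficientwise in the complex numbers.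
  The lemmas \<open>exp_ad_L1_finite\<close> and \<open>exp_ad_L0_sums\<close> below show that the series converges
  (and is even finite in the first case) for the operators it is applied to.
\<close>

definition exp_op :: "(witt \<Rightarrow> witt) \<Rightarrow> witt \<Rightarrow> witt" where
  "exp_op T y = Abs_witt (\<lambda>i. \<Sum>k. 1 / fact k * coeff ((T ^^ k) y) i)"

lemma coeff_exp_op: "coeff (exp_op T y) i = (\<Sum>k. 1 / fact k * coeff ((T ^^ k) y) i)"
  unfolding exp_op_def by (subst Abs_witt_inverse) (auto simp: coeff_below)

definition lie_automorphism :: "(witt \<Rightarrow> witt) \<Rightarrow> bool" where
  "lie_automorphism f \<longleftrightarrow>
     Vector_Spaces.linear scale_witt scale_witt f \<and> bij f \<and>
     (\<forall>x y. f (bracket x y) = bracket (f x) (f y))"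

definition Aut :: "(witt \<Rightarrow> witt) monoid" where
  "Aut = \<lparr>carrier = {f. lie_automorphism f}, mult = (\<circ>), one = id\<rparr>"

lemma coeff_bracket:
  "coeff (bracket x y) i = (\<Sum>j = -1..i + 1. of_int (2 * j - i) * coeff x (i - j) * coeff y j)"
  by transfer simp

lemma bracket_L:
  assumes "-1 \<le> i" "-1 \<le> j"
  shows "bracket (L i) (L j) = of_int (j - i) *\<^sub>C L (i + j)"
proof (rule witt_eqI)
  fix n
  have "coeff (bracket (L i) (L j)) n =
      (\<Sum>k = -1..n + 1. if k = j then (if n = i + j then of_int (j - i) else 0) else 0)"
    unfolding coeff_bracket L.rep_eq by (rule sum.cong) (use assms in auto)
  also have "\<dots> = coeff (of_int (j - i) *\<^sub>C L (i + j)) n"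
    using assms by (cases "i = j") (auto simp: scale_witt.rep_eq L.rep_eq zero_witt.rep_eq)
  finally show "coeff (bracket (L i) (L j)) n = coeff (of_int (j - i) *\<^sub>C L (i + j)) n" .
qed

lemma L1_iff: "x \<in> L1 \<longleftrightarrow> (\<forall>i < 1. coeff x i = 0)"
proof
  assume x: "x \<in> L1"
  show "\<forall>i < 1. coeff x i = 0"
  proof (intro allI impI)
    fix i :: int assume "i < 1"
    then consider "i = 0" | "i = -1" | "i < -1" by linarith
    then show "coeff x i = 0"
      using x by cases (auto simp: L1_def coeff_below)
  qed
qed (simp add: L1_def)

lemma coeff_ad_L1_power:
  assumes "x \<in> L1" "i < int k - 1"
  shows "coeff ((ad x ^^ k) y) i = 0"
  using assms(2)
proof (induction k arbitrary: i)
  case 0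
  then show ?case by (simp add: coeff_below)
next
  case (Suc k)
  have "coeff x (i - j) = 0 \<or> coeff ((ad x ^^ k) y) j = 0" for j
    using Suc assms(1) by (cases "j < int k - 1") (auto simp: L1_iff)
  then show ?case
    by (auto simp: coeff_bracket intro!: sum.neutral)
qed

lemma exp_ad_L1_finite:
  assumes "x \<in> L1"
  shows "finite {k. coeff ((ad x ^^ k) y) i \<noteq> 0}"
proof (rule finite_subset)
  show "{k. coeff ((ad x ^^ k) y) i \<noteq> 0} \<subseteq> {..nat (i + 1)}"
    using coeff_ad_L1_power[OF assms, of i _ y] by (force simp: not_less)
qed simp

lemma coeff_ad_L0: "coeff (ad (L 0) y) i = of_int i * coeff y i"
proof -
  have "coeff (ad (L 0) y) i = (\<Sum>j = -1..i + 1. if j = i then of_int i * coeff y i else 0)"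
    unfolding coeff_bracket L.rep_eq by (rule sum.cong) auto
  then show ?thesis
    by (cases "i < -1") (auto simp: coeff_below)
qed

lemma exp_ad_L0_sums:
  "(\<lambda>k. 1 / fact k * coeff (((\<lambda>z. a *\<^sub>C ad (L 0) z) ^^ k) y) i)
     sums (exp (of_int i * a) * coeff y i)"
proof -
  have pow: "coeff (((\<lambda>z. a *\<^sub>C ad (L 0) z) ^^ k) y) i = (of_int i * a) ^ k * coeff y i" for k
    by (induction k) (simp_all add: scale_witt.rep_eq coeff_ad_L0)
  show ?thesis
    using sums_mult2[OF exp_converges[of "of_int i * a"], of "coeff y i"]
    by (simp add: pow scaleR_conv_of_real field_simps)
qed

lemma coeff_exp_ad_L0:
  "coeff (exp_op (\<lambda>z. a *\<^sub>C ad (L 0) z) y) i = exp (of_int i * a) * coeff y i"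
  using sums_unique[OF exp_ad_L0_sums] by (simp add: coeff_exp_op)

lemma lie_automorphism_inv:
  assumes "lie_automorphism f"
  shows "lie_automorphism (inv_into UNIV f)"
proof -
  let ?g = "inv_into UNIV f"
  have lin: "Vector_Spaces.linear scale_witt scale_witt f" and b: "bij f"
    and br: "\<And>x y. f (bracket x y) = bracket (f x) (f y)"
    using assms by (auto simp: lie_automorphism_def)
  have fg: "f (?g x) = x" for x using b by (simp add: bij_is_surj surj_f_inv_f)
  have inj: "f x = f y \<Longrightarrow> x = y" for x y using b by (simp add: bij_is_inj inj_eq)
  have "Vector_Spaces.linear scale_witt scale_witt ?g"
    by (intro Vector_Spaces.linear_iff[THEN iffD2] conjI allI witt.vector_space_axioms)
      (rule inj, simp add: fg Vector_Spaces.linear_iff[THEN iffD1, OF lin])+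
  moreover have "?g (bracket x y) = bracket (?g x) (?g y)" for x y
    by (rule inj) (simp add: fg br)
  ultimately show ?thesis
    using b by (simp add: lie_automorphism_def bij_imp_bij_inv)
qed

lemma group_Aut: "Group.group Aut"
proof (rule groupI)
  fix f assume f: "f \<in> carrier Aut"
  then have "bij f" by (simp add: Aut_def lie_automorphism_def)
  then show "\<exists>g \<in> carrier Aut. g \<otimes>\<^bsub>Aut\<^esub> f = \<one>\<^bsub>Aut\<^esub>"
    using f lie_automorphism_inv[of f]
    by (intro bexI[of _ "inv_into UNIV f"]) (auto simp: Aut_def bij_is_inj)
qed (auto simp: Aut_def lie_automorphism_def witt.module_hom_id Vector_Spaces.linear_compose
       witt.linear_id bij_comp o_assoc)

end

theory Submission
  imports Defs "HOL-Computational_Algebra.Formal_Power_Series"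
begin

text \<open>
  Reading \<open>L i\<close> as \<open>t\<^sup>i\<^sup>+\<^sup>1 d/dt\<close> turns the algebra into the formal vector fields \<open>f d/dt\<close> with
  \<open>f\<close> a power series, and the bracket into \<open>f g' - f' g\<close>.

  Every operator on the right-hand side is an automorphism. For the scaling by \<open>exp (i a)\<close> in
  degree \<open>i\<close> this is immediate. For \<open>x \<in> L1\<close>, the operator \<open>ad x\<close> is a derivation that raises
  degrees, so the divided powers satisfy the Leibniz rule and their sum preserves the bracket
  (\<open>bracket_exp_ad\<close>); the sum is the identity plus terms that only look at lower coefficients,
  so it can be inverted coefficient by coefficient (\<open>bij_exp_ad\<close>).

  Conversely, let \<open>f\<close> be an automorphism. No continuity is assumed, but the
  vector fields vanishing at the origin are characterised algebraically: they are exactly the \<open>x\<close>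
  for which \<open>ad x\<close> is not surjective (\<open>surj_ad_iff\<close>). Hence \<open>f\<close> preserves this hyperplane. In
  particular \<open>f (L (-1))\<close> has a nonzero leading coefficient \<open>c\<close>. Some \<open>exp (ad x)\<close> sends
  \<open>L (-1)\<close> to \<open>f (L (-1)) / c\<close>, because the coefficient of \<open>exp (ad x) (L (-1))\<close> in degree \<open>i\<close>
  contains the new unknown \<open>coeff x (i + 1)\<close> linearly with a nonzero factor
  (\<open>exp_ad_transitive\<close>), and the scaling supplies the factor \<open>c\<close>. Thus \<open>f\<close> agrees on \<open>L (-1)\<close>
  with an automorphism of the required form. The two are equal, since an automorphism that fixes
  \<open>L (-1) = d/dt\<close> commutes with differentiation and preserves the value at the origin, and
  therefore preserves all Taylor coefficients (\<open>automorphism_fixing_L_minus_1\<close>).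
\<close>

section \<open>The bracket as a bracket of vector fields\<close>

lemmas coeff_simps = zero_witt.rep_eq plus_witt.rep_eq uminus_witt.rep_eq minus_witt.rep_eq
  scale_witt.rep_eq

lemma coeff_sum: "coeff (sum f A) i = (\<Sum>k\<in>A. coeff (f k) i)"
  by (induction A rule: infinite_finite_induct) (simp_all add: coeff_simps)

lemma bracket_add_left: "bracket (x + y) z = bracket x z + bracket y z"
  by (rule witt_eqI) (simp add: coeff_bracket coeff_simps distrib_left distrib_right sum.distrib)

lemma bracket_add_right: "bracket x (y + z) = bracket x y + bracket x z"
  by (rule witt_eqI) (simp add: coeff_bracket coeff_simps distrib_left distrib_right sum.distrib)

lemma bracket_scale_left: "bracket (c *\<^sub>C x) y = c *\<^sub>C bracket x y"
  by (rule witt_eqI) (simp add: coeff_bracket coeff_simps sum_distrib_left mult_ac)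

lemma bracket_scale_right: "bracket x (c *\<^sub>C y) = c *\<^sub>C bracket x y"
  by (rule witt_eqI) (simp add: coeff_bracket coeff_simps sum_distrib_left mult_ac)

lemma bracket_zero_left: "bracket 0 y = 0"
  by (rule witt_eqI) (simp add: coeff_bracket coeff_simps)

lemma bracket_zero_right: "bracket x 0 = 0"
  by (rule witt_eqI) (simp add: coeff_bracket coeff_simps)

lemma bracket_sum_left: "bracket (sum f A) y = (\<Sum>k\<in>A. bracket (f k) y)"
  by (induction A rule: infinite_finite_induct)
    (simp_all add: bracket_zero_left bracket_add_left)

lemma bracket_sum_right: "bracket x (sum f A) = (\<Sum>k\<in>A. bracket x (f k))"
  by (induction A rule: infinite_finite_induct)
    (simp_all add: bracket_zero_right bracket_add_right)

text \<open>
  The power series \<open>f\<close> such that \<open>x\<close> is the vector field \<open>f d/dt\<close>. The Jacobi identity, in the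
  form that \<open>ad x\<close> is a derivation, becomes the product rule for power series.
\<close>

definition symbol :: "witt \<Rightarrow> complex fps" where
  "symbol x = Abs_fps (\<lambda>n. coeff x (int n - 1))"

lemma symbol_inject: "symbol x = symbol y \<longleftrightarrow> x = y"
proof
  assume eq: "symbol x = symbol y"
  show "x = y"
  proof (rule witt_eqI)
    fix i
    have "fps_nth (symbol x) (nat (i + 1)) = fps_nth (symbol y) (nat (i + 1))"
      by (simp add: eq)
    then show "coeff x i = coeff y i"
      by (cases "i < -1") (simp_all add: symbol_def coeff_below)
  qed
qed simp

lemma symbol_add: "symbol (x + y) = symbol x + symbol y"
  by (simp add: fps_eq_iff symbol_def coeff_simps)

lemma symbol_bracket:
  "symbol (bracket x y) = symbol x * fps_deriv (symbol y) - fps_deriv (symbol x) * symbol y"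
proof (rule fps_ext)
  fix n
  let ?f = "fps_nth (symbol x)" and ?g = "fps_nth (symbol y)"
  have "fps_nth (symbol (bracket x y)) n
      = (\<Sum>j = -1..int n. of_int (2 * j - (int n - 1)) * coeff x (int n - 1 - j) * coeff y j)"
    by (simp add: symbol_def coeff_bracket)
  also have "\<dots> = (\<Sum>m = 0..Suc n. (of_nat m - of_nat (Suc n - m)) * (?f (Suc n - m) * ?g m))"
    by (rule sum.reindex_bij_witness[of _ "\<lambda>m. int m - 1" "\<lambda>j. nat (j + 1)"])
      (auto simp: symbol_def of_nat_diff algebra_simps)
  also have "\<dots> = (\<Sum>m = 0..Suc n. of_nat m * (?f (Suc n - m) * ?g m))
                - (\<Sum>m = 0..Suc n. of_nat (Suc n - m) * (?f (Suc n - m) * ?g m))"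
    by (simp only: left_diff_distrib sum_subtractf)
  also have "(\<Sum>m = 0..Suc n. of_nat m * (?f (Suc n - m) * ?g m))
      = (\<Sum>m = 0..n. ?f (n - m) * (of_nat (Suc m) * ?g (Suc m)))"
    by (subst sum.atLeast0_atMost_Suc_shift) (simp add: mult_ac)
  also have "\<dots> = fps_nth (fps_deriv (symbol y) * symbol x) n"
    unfolding fps_mult_nth by (rule sum.cong) (simp_all add: mult_ac)
  also have "(\<Sum>m = 0..Suc n. of_nat (Suc n - m) * (?f (Suc n - m) * ?g m))
      = (\<Sum>m = 0..n. ?g m * (of_nat (Suc (n - m)) * ?f (Suc (n - m))))"
    by (auto simp: Suc_diff_le mult_ac simp del: of_nat_Suc of_nat_diff intro!: sum.cong)
  also have "\<dots> = fps_nth (symbol y * fps_deriv (symbol x)) n"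
    by (simp add: fps_mult_nth)
  finally show "fps_nth (symbol (bracket x y)) n
      = fps_nth (symbol x * fps_deriv (symbol y) - fps_deriv (symbol x) * symbol y) n"
    by (simp add: mult.commute)
qed

lemma ad_derivation: "ad x (bracket y z) = bracket (ad x y) z + bracket y (ad x z)"
  unfolding symbol_inject[symmetric]
  by (simp add: symbol_add symbol_bracket algebra_simps)

section \<open>Solving equations coefficient by coefficient\<close>

text \<open>
  Surjectivity of \<open>ad\<close>, invertibility of \<open>exp (ad x)\<close> and the choice of \<open>x\<close> in the
  classification all amount to triangular systems: each coefficient of the unknown
  is prescribed in terms of the preceding ones. The index \<open>m\<close> at which the unknown starts differs
  between these applications.
\<close>

lemma triangular_system_ex1:
  fixes m :: int and G :: "int \<Rightarrow> witt \<Rightarrow> complex"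
  assumes m: "-1 \<le> m"
    and G: "\<And>i x y. \<lbrakk>m \<le> i; \<And>j. j < m \<Longrightarrow> coeff x j = 0; \<And>j. j < m \<Longrightarrow> coeff y j = 0;
                     \<And>j. j < i \<Longrightarrow> coeff x j = coeff y j\<rbrakk> \<Longrightarrow> G i x = G i y"
  shows "\<exists>!x. \<forall>i. coeff x i = (if i < m then 0 else G i x)"
proof -
  define W where "W a = Abs_witt (\<lambda>j. if j < m then 0 else a j)" for a :: "int \<Rightarrow> complex"
  have W: "coeff (W a) j = (if j < m then 0 else a j)" for a j
    using m unfolding W_def by (subst Abs_witt_inverse) auto
  have "\<exists>a. \<forall>i. a i = (if i < m then 0 else G i (W a))"
  proof (rule dependent_wf_choice[OF wf_int_ge_less_than[of m],
        where P = "\<lambda>a i r. r = (if i < m then 0 else G i (W a))"])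
    fix a b :: "int \<Rightarrow> complex" and i r
    assume "\<And>j. (j, i) \<in> int_ge_less_than m \<Longrightarrow> a j = b j"
    then have "G i (W a) = G i (W b)" if "m \<le> i"
      using that by (intro G) (auto simp: W int_ge_less_than_def)
    then show "(r = (if i < m then 0 else G i (W a))) = (r = (if i < m then 0 else G i (W b)))"
      by auto
  qed auto
  then obtain a where a: "\<And>i. a i = (if i < m then 0 else G i (W a))"
    by blast
  show ?thesis
  proof (rule ex1I)
    show "\<forall>i. coeff (W a) i = (if i < m then 0 else G i (W a))"
      using a by (simp add: W)
  next
    fix x assume x: "\<forall>i. coeff x i = (if i < m then 0 else G i x)"
    have "coeff x i = coeff (W a) i" for i
    proof (induction i rule: wf_induct_rule[OF wf_int_ge_less_than[of m]])
      case (1 i)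
      have "G i x = G i (W a)" if "m \<le> i"
      proof (rule G[OF that])
        show "coeff x j = coeff (W a) j" if "j < i" for j
          using 1[of j] x that by (cases "j < m") (auto simp: W int_ge_less_than_def)
      qed (use x in \<open>auto simp: W\<close>)
      then show ?case
        using x a[of i] by (auto simp: W)
    qed
    then show "x = W a" by (rule witt_eqI)
  qed
qed

section \<open>Exponentials of positive degree\<close>

lemma funpow_ad_add: "(ad x ^^ k) (y + z) = (ad x ^^ k) y + (ad x ^^ k) z"
  by (induction k) (simp_all add: bracket_add_right)

lemma funpow_ad_scale: "(ad x ^^ k) (c *\<^sub>C y) = c *\<^sub>C (ad x ^^ k) y"
  by (induction k) (simp_all add: bracket_scale_right)

text \<open>
  The divided powers \<open>(ad x)^k / k!\<close> make the Leibniz rule free of binomial coefficients.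
\<close>

definition ad_dpow :: "witt \<Rightarrow> nat \<Rightarrow> witt \<Rightarrow> witt" where
  "ad_dpow x k y = (1 / fact k) *\<^sub>C (ad x ^^ k) y"

lemma ad_dpow_0: "ad_dpow x 0 y = y"
  by (simp add: ad_dpow_def)

lemma ad_dpow_1: "ad_dpow x (Suc 0) y = ad x y"
  by (simp add: ad_dpow_def)

lemma ad_ad_dpow: "ad x (ad_dpow x k y) = of_nat (Suc k) *\<^sub>C ad_dpow x (Suc k) y"
  by (simp add: ad_dpow_def bracket_scale_right divide_simps del: of_nat_Suc)

lemma ad_dpow_bracket:
  "ad_dpow x n (bracket y z) = (\<Sum>k\<le>n. bracket (ad_dpow x k y) (ad_dpow x (n - k) z))"
proof (induction n)
  case 0
  then show ?case by (simp add: ad_dpow_0)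
next
  case (Suc n)
  let ?B = "\<lambda>k l. bracket (ad_dpow x k y) (ad_dpow x l z)"
  have "of_nat (Suc n) *\<^sub>C ad_dpow x (Suc n) (bracket y z) = (\<Sum>k\<le>n. ad x (?B k (n - k)))"
    by (simp only: ad_ad_dpow[symmetric] Suc bracket_sum_right)
  also have "\<dots> = (\<Sum>k\<le>n. of_nat (Suc k) *\<^sub>C ?B (Suc k) (n - k))
                + (\<Sum>k\<le>n. of_nat (Suc (n - k)) *\<^sub>C ?B k (Suc (n - k)))"
    by (simp only: ad_derivation ad_ad_dpow bracket_scale_left bracket_scale_right sum.distrib)
  also have "(\<Sum>k\<le>n. of_nat (Suc k) *\<^sub>C ?B (Suc k) (n - k))
      = (\<Sum>k\<le>Suc n. of_nat k *\<^sub>C ?B k (Suc n - k))"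
    by (subst sum.atMost_Suc_shift) (simp del: of_nat_Suc)
  also have "(\<Sum>k\<le>n. of_nat (Suc (n - k)) *\<^sub>C ?B k (Suc (n - k)))
      = (\<Sum>k\<le>Suc n. of_nat (Suc n - k) *\<^sub>C ?B k (Suc n - k))"
    by (simp add: Suc_diff_le del: of_nat_Suc of_nat_diff cong: sum.cong_simp)
  also have "(\<Sum>k\<le>Suc n. of_nat k *\<^sub>C ?B k (Suc n - k))
        + (\<Sum>k\<le>Suc n. of_nat (Suc n - k) *\<^sub>C ?B k (Suc n - k))
      = (\<Sum>k\<le>Suc n. of_nat (Suc n) *\<^sub>C ?B k (Suc n - k))"
    unfolding sum.distrib[symmetric] witt.scale_left_distrib[symmetric] of_nat_add[symmetric]
    by (rule sum.cong) simp_all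
  also have "\<dots> = of_nat (Suc n) *\<^sub>C (\<Sum>k\<le>Suc n. ?B k (Suc n - k))"
    by (simp only: witt.scale_sum_right)
  finally show ?case
    by (simp only: witt.scale_cancel_left of_nat_eq_0_iff) simp
qed

lemma coeff_ad_dpow_eq_0: "x \<in> L1 \<Longrightarrow> i < int k - 1 \<Longrightarrow> coeff (ad_dpow x k y) i = 0"
  by (simp add: ad_dpow_def coeff_simps coeff_ad_L1_power)

lemma coeff_exp_ad:
  assumes "x \<in> L1" "i < int N"
  shows "coeff (exp_op (ad x) y) i = (\<Sum>k\<le>N. coeff (ad_dpow x k y) i)"
proof -
  have "coeff (exp_op (ad x) y) i = (\<Sum>k. coeff (ad_dpow x k y) i)"
    by (simp add: coeff_exp_op ad_dpow_def coeff_simps)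
  also have "\<dots> = (\<Sum>k\<le>N. coeff (ad_dpow x k y) i)"
    by (rule suminf_finite) (use assms in \<open>auto intro!: coeff_ad_dpow_eq_0\<close>)
  finally show ?thesis .
qed

lemma coeff_bracket_cong:
  assumes "\<And>j. j \<le> i + 1 \<Longrightarrow> coeff x j = coeff x' j" "\<And>j. j \<le> i + 1 \<Longrightarrow> coeff y j = coeff y' j"
  shows "coeff (bracket x y) i = coeff (bracket x' y') i"
  unfolding coeff_bracket by (rule sum.cong) (use assms in auto)

lemma coeff_bracket_eq_0:
  assumes "\<And>j. j < p \<Longrightarrow> coeff x j = 0" "\<And>j. j < q \<Longrightarrow> coeff y j = 0" "i < p + q"
  shows "coeff (bracket x y) i = 0"
proof -
  have "coeff x (i - j) = 0 \<or> coeff y j = 0" for j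
    using assms by (cases "j < q") auto
  then show ?thesis
    by (auto simp: coeff_bracket intro!: sum.neutral)
qed

text \<open>
  The coefficient in degree \<open>i\<close> only sees the exponential series up to order \<open>i + 2\<close>, so the
  identity reduces to the Leibniz rule and a rearrangement of a finite double sum.
\<close>

lemma bracket_exp_ad:
  assumes x: "x \<in> L1"
  shows "exp_op (ad x) (bracket y z) = bracket (exp_op (ad x) y) (exp_op (ad x) z)"
proof (rule witt_eqI)
  fix i
  define N where "N = nat (i + 2)"
  let ?B = "\<lambda>k l. coeff (bracket (ad_dpow x k y) (ad_dpow x l z)) i"
  show "coeff (exp_op (ad x) (bracket y z)) i
      = coeff (bracket (exp_op (ad x) y) (exp_op (ad x) z)) i"
  proof (cases "i < -1")
    case True
    then show ?thesis by (simp add: coeff_below)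
  next
    case False
    have "coeff (bracket (exp_op (ad x) y) (exp_op (ad x) z)) i
        = coeff (bracket (\<Sum>k\<le>N. ad_dpow x k y) (\<Sum>l\<le>N. ad_dpow x l z)) i"
      using False by (intro coeff_bracket_cong) (simp_all add: coeff_sum coeff_exp_ad[OF x] N_def)
    also have "\<dots> = (\<Sum>(k, l)\<in>{..N} \<times> {..N}. ?B k l)"
      by (simp add: bracket_sum_left bracket_sum_right coeff_sum)
        (subst sum.swap, simp add: sum.cartesian_product)
    also have "\<dots> = (\<Sum>(k, l)\<in>{(k, l). k + l \<le> N}. ?B k l)"
    proof (rule sum.mono_neutral_right)
      have "?B k l = 0" if "\<not> k + l \<le> N" for k l
        by (rule coeff_bracket_eq_0[of "int k - 1" _ "int l - 1"])
          (use that False in \<open>auto simp: N_def coeff_ad_dpow_eq_0[OF x]\<close>)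
      then show "\<forall>p \<in> {..N} \<times> {..N} - {(k, l). k + l \<le> N}. (case p of (k, l) \<Rightarrow> ?B k l) = 0"
        by auto
    qed auto
    also have "\<dots> = (\<Sum>n\<le>N. \<Sum>k\<le>n. ?B k (n - k))"
      by (rule sum.triangle_reindex_eq)
    also have "\<dots> = coeff (exp_op (ad x) (bracket y z)) i"
      using False by (simp add: coeff_exp_ad[OF x, of i N] N_def ad_dpow_bracket coeff_sum)
    finally show ?thesis ..
  qed
qed

lemma linear_exp_ad:
  assumes x: "x \<in> L1"
  shows "Vector_Spaces.linear scale_witt scale_witt (exp_op (ad x))"
proof (intro Vector_Spaces.linear_iff[THEN iffD2] conjI allI witt.vector_space_axioms)
  have ser: "coeff (exp_op (ad x) y) i = (\<Sum>k\<le>nat (i + 1). 1 / fact k * coeff ((ad x ^^ k) y) i)"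
    for y i
  proof (cases "i < -1")
    case True
    then show ?thesis by (simp add: coeff_below)
  next
    case False
    then show ?thesis
      by (subst coeff_exp_ad[OF x, of i "nat (i + 1)"]) (simp_all add: ad_dpow_def coeff_simps)
  qed
  show "exp_op (ad x) (y + z) = exp_op (ad x) y + exp_op (ad x) z" for y z
    by (rule witt_eqI)
      (simp only: ser plus_witt.rep_eq funpow_ad_add distrib_left sum.distrib)
  show "exp_op (ad x) (c *\<^sub>C y) = c *\<^sub>C exp_op (ad x) y" for c y
    by (rule witt_eqI)
      (simp only: ser scale_witt.rep_eq funpow_ad_scale sum_distrib_left mult.left_commute)
qed

lemma coeff_ad_L1_cong:
  assumes "x \<in> L1" "\<And>j. j < i \<Longrightarrow> coeff y j = coeff z j"
  shows "coeff (ad x y) i = coeff (ad x z) i"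
proof -
  have "coeff x (i - j) * coeff y j = coeff x (i - j) * coeff z j" for j
    using assms by (cases "j < i") (auto simp: L1_iff)
  then show ?thesis
    by (simp only: coeff_bracket mult.assoc)
qed

lemma coeff_ad_dpow_Suc_cong:
  assumes x: "x \<in> L1" and agree: "\<And>j. j < i \<Longrightarrow> coeff y j = coeff z j"
  shows "coeff (ad_dpow x (Suc k) y) i = coeff (ad_dpow x (Suc k) z) i"
proof -
  have "coeff ((ad x ^^ k) y) j = coeff ((ad x ^^ k) z) j" if "j < i" for j
    using that
  proof (induction k arbitrary: j)
    case (Suc k)
    then show ?case by (auto intro!: coeff_ad_L1_cong[OF x])
  qed (simp add: agree)
  then have "coeff (ad x ((ad x ^^ k) y)) i = coeff (ad x ((ad x ^^ k) z)) i"
    by (rule coeff_ad_L1_cong[OF x])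
  then show ?thesis
    by (simp add: ad_dpow_def coeff_simps)
qed

text \<open>
  As an equation for \<open>y\<close>, \<open>exp (ad x) y = z\<close> is unitriangular: all terms of the series except the zeroth
  involve only lower coefficients of \<open>y\<close>.
\<close>

lemma bij_exp_ad:
  assumes x: "x \<in> L1"
  shows "bij (exp_op (ad x))"
  unfolding bij_iff
proof
  fix z
  define G where "G i y = coeff z i - (\<Sum>k<nat (i + 1). coeff (ad_dpow x (Suc k) y) i)" for i y
  have "\<exists>!y. \<forall>i. coeff y i = (if i < -1 then 0 else G i y)"
    by (rule triangular_system_ex1) (auto simp: G_def intro!: sum.cong coeff_ad_dpow_Suc_cong[OF x])
  moreover have "(\<forall>i. coeff y i = (if i < -1 then 0 else G i y)) \<longleftrightarrow> exp_op (ad x) y = z" for y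
  proof -
    have "coeff (exp_op (ad x) y) i = coeff z i \<longleftrightarrow> coeff y i = (if i < -1 then 0 else G i y)" for i
    proof (cases "i < -1")
      case True
      then show ?thesis by (simp add: coeff_below)
    next
      case False
      then have "coeff (exp_op (ad x) y) i
          = coeff y i + (\<Sum>k<nat (i + 1). coeff (ad_dpow x (Suc k) y) i)"
        by (simp add: coeff_exp_ad[OF x, of i "nat (i + 1)"] sum.atMost_shift ad_dpow_0)
      with False show ?thesis
        by (auto simp: G_def algebra_simps)
    qed
    then show ?thesis
      by (auto intro: witt_eqI)
  qed
  ultimately show "\<exists>!y. exp_op (ad x) y = z" by simp
qed

lemma lie_automorphism_exp_ad: "x \<in> L1 \<Longrightarrow> lie_automorphism (exp_op (ad x))"
  by (simp add: lie_automorphism_def linear_exp_ad bij_exp_ad bracket_exp_ad)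

lemma lie_automorphism_exp_ad_L0: "lie_automorphism (exp_op (\<lambda>y. a *\<^sub>C ad (L 0) y))"
proof -
  let ?S = "\<lambda>a. exp_op (\<lambda>y. a *\<^sub>C ad (L 0) y)"
  have inv: "?S a (?S b y) = y" if "a + b = 0" for a b y
  proof (rule witt_eqI)
    fix i
    have "exp (of_int i * a) * exp (of_int i * b) = 1"
      using that by (simp add: exp_add[symmetric] distrib_left[symmetric])
    then show "coeff (?S a (?S b y)) i = coeff y i"
      by (simp add: coeff_exp_ad_L0 mult.assoc[symmetric])
  qed
  have "bij (?S a)"
  proof (rule o_bij)
    show "?S (- a) \<circ> ?S a = id"
      by (rule ext) (simp only: comp_apply id_apply inv left_minus)
    show "?S a \<circ> ?S (- a) = id"
      by (rule ext) (simp only: comp_apply id_apply inv right_minus)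
  qed
  moreover have "Vector_Spaces.linear scale_witt scale_witt (?S a)"
    by (intro Vector_Spaces.linear_iff[THEN iffD2] conjI allI witt.vector_space_axioms;
        rule witt_eqI) (simp_all add: coeff_exp_ad_L0 coeff_simps algebra_simps)
  moreover have "?S a (bracket y z) = bracket (?S a y) (?S a z)" for y z
  proof (rule witt_eqI)
    fix i
    have split: "exp (of_int i * a) = exp (of_int (i - j) * a) * exp (of_int j * a)" for j
      by (simp add: exp_add[symmetric] algebra_simps)
    have "exp (of_int i * a) * (of_int (2 * j - i) * coeff y (i - j) * coeff z j)
        = of_int (2 * j - i) * (exp (of_int (i - j) * a) * coeff y (i - j))
            * (exp (of_int j * a) * coeff z j)" for j
      by (subst split[of j]) (simp only: mult_ac)
    then show "coeff (?S a (bracket y z)) i = coeff (bracket (?S a y) (?S a z)) i"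
      unfolding coeff_exp_ad_L0 coeff_bracket sum_distrib_left by (rule sum.cong[OF refl])
  qed
  ultimately show ?thesis
    by (simp add: lie_automorphism_def)
qed

lemma lie_automorphism_comp:
  "lie_automorphism f \<Longrightarrow> lie_automorphism g \<Longrightarrow> lie_automorphism (f \<circ> g)"
  using Group.monoid.m_closed[OF group.is_monoid[OF group_Aut], of f g] by (simp add: Aut_def)

section \<open>The invariant hyperplane\<close>

text \<open>
  If \<open>x\<close> does not vanish at the origin then \<open>[x, y] = z\<close> is a differential equation for \<open>y\<close> with
  invertible leading coefficient. If it does, then the coefficients of \<open>[x, y]\<close> in degrees \<open>-1\<close>
  and \<open>0\<close> are a common multiple of \<open>coeff x 0\<close> and \<open>2 * coeff x 1\<close>, so they cannot be arbitrary.
\<close>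

lemma surj_ad_iff: "surj (ad x) \<longleftrightarrow> coeff x (-1) \<noteq> 0"
proof
  assume nz: "coeff x (-1) \<noteq> 0"
  show "surj (ad x)"
    unfolding surj_def
  proof
    fix z
    let ?t = "\<lambda>i j y. of_int (2 * j - i) * coeff x (i - j) * coeff y j"
    define G where "G i y = (coeff z (i - 1) - (\<Sum>j = -1..i - 1. ?t (i - 1) j y))
      / (of_int (i + 1) * coeff x (-1))" for i y
    have "\<exists>!y. \<forall>i. coeff y i = (if i < 0 then 0 else G i y)"
      by (rule triangular_system_ex1) (auto simp: G_def intro!: sum.cong arg_cong2[of _ _ _ _ "(/)"])
    then obtain y where y: "\<And>i. 0 \<le> i \<Longrightarrow> coeff y i = G i y"
      by (metis linorder_not_less)
    have "coeff z i = coeff (ad x y) i" for i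
    proof (cases "i < -1")
      case False
      then have "{-1..i + 1} = insert (i + 1) {-1..i}" by auto
      moreover have "of_int (i + 2) * coeff x (-1) \<noteq> (0 :: complex)"
        using nz False by (simp only: mult_eq_0_iff of_int_eq_0_iff) simp
      ultimately show ?thesis
        using y[of "i + 1"] False by (simp add: coeff_bracket G_def field_simps)
    qed (simp add: coeff_below)
    then show "\<exists>y. z = ad x y" by (blast intro: witt_eqI)
  qed
next
  assume surj: "surj (ad x)"
  show "coeff x (-1) \<noteq> 0"
  proof
    assume z: "coeff x (-1) = 0"
    have "{-1..0} = {-1, 0 :: int}" "{-1..1} = {-1, 0, 1 :: int}" by auto
    then have m1: "coeff (ad x y) (-1) = - coeff x 0 * coeff y (-1)"
      and c0: "coeff (ad x y) 0 = - 2 * coeff x 1 * coeff y (-1)" for y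
      using z by (simp_all add: coeff_bracket)
    \<comment> \<open>Reaching \<open>L (-1)\<close> requires \<open>coeff y (-1) \<noteq> 0\<close>, so its degree \<open>0\<close> part forces \<open>coeff x 1 = 0\<close>;
      but then no image has a component along \<open>L 0\<close>.\<close>
    obtain y where "ad x y = L (-1)" using surj by (metis surjD)
    with m1[of y] c0[of y] have "coeff x 1 = 0"
      by (auto simp: L.rep_eq)
    moreover obtain y' where "ad x y' = L 0" using surj by (metis surjD)
    ultimately show False
      using c0[of y'] by (simp add: L.rep_eq)
  qed
qed

lemma lie_automorphism_hyperplane:
  assumes "lie_automorphism f"
  shows "coeff (f x) (-1) = 0 \<longleftrightarrow> coeff x (-1) = 0"
proof -
  have b: "bij f" and br: "\<And>x y. f (bracket x y) = bracket (f x) (f y)"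
    using assms by (auto simp: lie_automorphism_def)
  have "ad (f x) \<circ> f = f \<circ> ad x"
    by (simp add: fun_eq_iff br)
  then have "surj (ad (f x)) \<longleftrightarrow> surj (ad x)"
    using b by (metis (no_types, lifting) bij_is_inj bij_is_surj comp_surj image_comp inj_image_eq_iff)
  then show ?thesis
    by (simp add: surj_ad_iff)
qed

section \<open>Automorphisms are determined by the image of d/dt\<close>

lemma coeff_ad_L_minus_1:
  assumes "-1 \<le> i"
  shows "coeff (ad (L (-1)) y) i = of_int (i + 2) * coeff y (i + 1)"
proof -
  have "coeff (ad (L (-1)) y) i
      = (\<Sum>j = -1..i + 1. if j = i + 1 then of_int (i + 2) * coeff y (i + 1) else 0)"
    unfolding coeff_bracket L.rep_eq by (rule sum.cong) auto
  then show ?thesis using assms by simp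
qed

lemma coeff_bracket_L_minus_1:
  assumes "-1 \<le> i"
  shows "coeff (bracket x (L (-1))) i = - of_int (i + 2) * coeff x (i + 1)"
proof -
  have "coeff (bracket x (L (-1))) i
      = (\<Sum>j = -1..i + 1. if j = -1 then - of_int (i + 2) * coeff x (i + 1) else 0)"
    unfolding coeff_bracket L.rep_eq by (rule sum.cong) auto
  then show ?thesis using assms by simp
qed

text \<open>
  The value at the origin is preserved because \<open>h\<close> fixes \<open>L (-1)\<close> and maps the complementary
  hyperplane to itself. The other coefficients are, up to nonzero factors, values at the origin
  of iterated brackets with \<open>L (-1)\<close>.
\<close>

lemma automorphism_fixing_L_minus_1:
  assumes h: "lie_automorphism h" and fix1: "h (L (-1)) = L (-1)"
  shows "h y = y"
proof -
  have lin: "h (x + y) = h x + h y" "h (c *\<^sub>C x) = c *\<^sub>C h x" for x y c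
    using h by (simp_all add: lie_automorphism_def Vector_Spaces.linear_iff)
  have comm: "h (ad (L (-1)) y) = ad (L (-1)) (h y)" for y
    using h fix1 by (simp add: lie_automorphism_def)
  have top: "coeff (h y) (-1) = coeff y (-1)" for y
  proof -
    define w where "w = y + (- coeff y (-1)) *\<^sub>C L (-1)"
    have "coeff (h w) (-1) = 0"
      unfolding lie_automorphism_hyperplane[OF h] by (simp add: w_def coeff_simps L.rep_eq)
    moreover have "h w = h y + (- coeff y (-1)) *\<^sub>C L (-1)"
      by (simp only: w_def lin fix1)
    ultimately show ?thesis
      by (simp add: coeff_simps L.rep_eq)
  qed
  have "coeff (h y) i = coeff y i" if "-1 \<le> i" for i y
    using that
  proof (induction i arbitrary: y rule: int_ge_induct)
    case base
    show ?case by (rule top)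
  next
    case (step i)
    have "of_int (i + 2) * coeff (h y) (i + 1) = coeff (h (ad (L (-1)) y)) i"
      by (simp only: comm coeff_ad_L_minus_1[OF step.hyps])
    also have "\<dots> = of_int (i + 2) * coeff y (i + 1)"
      by (simp only: step.IH coeff_ad_L_minus_1[OF step.hyps])
    finally show ?case
      using step.hyps by (simp only: mult_cancel_left of_int_eq_0_iff) simp
  qed
  then show ?thesis
    by (metis coeff_below linorder_not_less witt_eqI)
qed

text \<open>
  In degree \<open>n - 1\<close> the linear term of \<open>exp (ad x) (L (-1))\<close> is \<open>-(n + 1) * coeff x n\<close>. To solve
  for \<open>coeff x n\<close>, the terms of higher order must not contain it. Bracketing \<open>x\<close> with an element
  reaches \<open>coeff x n\<close> in degree \<open>n - 1\<close> only through the \<open>L (-1)\<close> component of that element, and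
  no iterated bracket beyond the zeroth has such a component.
\<close>

lemma coeff_ad_dpow_L_minus_1_cong:
  assumes x: "x \<in> L1" "x' \<in> L1" and agree: "\<And>j. j < n \<Longrightarrow> coeff x j = coeff x' j"
  shows "coeff (ad_dpow x (Suc (Suc k)) (L (-1))) (n - 1)
       = coeff (ad_dpow x' (Suc (Suc k)) (L (-1))) (n - 1)"
proof -
  let ?z = "\<lambda>x k. (ad x ^^ k) (L (-1))"
  have low: "coeff (?z x k) j = coeff (?z x' k) j" if "j < n - 1" for k j
    using that
  proof (induction k arbitrary: j)
    case (Suc k)
    have "coeff x (j - l) * coeff (?z x k) l = coeff x' (j - l) * coeff (?z x' k) l"
      if "-1 \<le> l" for l
      using Suc agree[of "j - l"] x that by (cases "l < j") (auto simp: L1_iff)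
    then show ?case
      by (auto simp: coeff_bracket mult.assoc intro!: sum.cong)
  qed simp
  have "coeff x (n - 1 - l) * coeff (?z x (Suc k)) l = coeff x' (n - 1 - l) * coeff (?z x' (Suc k)) l"
    if "-1 \<le> l" for l
  proof (cases "l = -1")
    case True
    \<comment> \<open>Here the coefficients of \<open>x\<close> and \<open>x'\<close> of index \<open>n\<close> occur, but with factor zero.\<close>
    then show ?thesis
      using coeff_ad_L1_power[OF x(1), of l "Suc k"] coeff_ad_L1_power[OF x(2), of l "Suc k"] by simp
  next
    case False
    then show ?thesis
      using that agree[of "n - 1 - l"] low[of l "Suc k"] x
      by (cases "l < n - 1") (auto simp: L1_iff simp del: funpow.simps)
  qed
  then have "coeff (?z x (Suc (Suc k))) (n - 1) = coeff (?z x' (Suc (Suc k))) (n - 1)"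
    by (subst (1 2) funpow.simps(2))
      (auto simp: coeff_bracket mult.assoc simp del: funpow.simps intro!: sum.cong)
  then show ?thesis
    by (simp only: ad_dpow_def coeff_simps)
qed

lemma exp_ad_transitive:
  assumes v: "coeff v (-1) = 1"
  obtains x where "x \<in> L1" "exp_op (ad x) (L (-1)) = v"
proof -
  define G where "G n x = ((\<Sum>k<nat n. coeff (ad_dpow x (Suc (Suc k)) (L (-1))) (n - 1))
    - coeff v (n - 1)) / of_int (n + 1)" for n x
  have "\<exists>!x. \<forall>n. coeff x n = (if n < 1 then 0 else G n x)"
    by (rule triangular_system_ex1)
      (auto simp: G_def L1_iff intro!: arg_cong2[of _ _ _ _ "(/)"] sum.cong
          coeff_ad_dpow_L_minus_1_cong)
  then obtain x where x: "\<And>n. coeff x n = (if n < 1 then 0 else G n x)"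
    by blast
  then have L1: "x \<in> L1"
    unfolding L1_iff by simp
  have "coeff (exp_op (ad x) (L (-1))) i = coeff v i" for i
  proof -
    consider "i < -1" | "i = -1" | "0 \<le> i" by linarith
    then show ?thesis
    proof cases
      case 1
      then show ?thesis by (simp add: coeff_below)
    next
      case 2
      then show ?thesis
        using v by (simp add: coeff_exp_ad[OF L1, of _ 0] ad_dpow_0 L.rep_eq)
    next
      case 3
      define S where "S = (\<Sum>k<nat (i + 1). coeff (ad_dpow x (Suc (Suc k)) (L (-1))) i)"
      have "coeff (exp_op (ad x) (L (-1))) i
          = (\<Sum>k\<le>Suc (nat (i + 1)). coeff (ad_dpow x k (L (-1))) i)"
        using 3 by (simp add: coeff_exp_ad[OF L1, of i "Suc (nat (i + 1))"])
      also have "\<dots> = coeff (L (-1)) i + coeff (ad x (L (-1))) i + S"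
        by (subst sum.atMost_Suc_shift, subst sum.atMost_shift) (simp add: ad_dpow_0 ad_dpow_1 S_def)
      also have "\<dots> = S - of_int (i + 2) * coeff x (i + 1)"
        using 3 by (simp add: L.rep_eq coeff_bracket_L_minus_1 algebra_simps)
      also have "\<dots> = coeff v i"
      proof -
        have "of_int (i + 2) \<noteq> (0 :: complex)"
          using 3 by (simp only: of_int_eq_0_iff)
        moreover have "coeff x (i + 1) = (S - coeff v i) / of_int (i + 2)"
          using 3 x[of "i + 1"] by (simp add: G_def S_def add.commute)
        ultimately show ?thesis
          by (simp del: of_int_add)
      qed
      finally show ?thesis .
    qed
  qed
  then show ?thesis
    using L1 that witt_eqI by blast
qed

section \<open>The automorphism group\<close>

theorem theorem5p9:
  shows "carrier Aut =
    {exp_op (ad x) \<circ> exp_op (\<lambda>y. a\<^sub>0 *\<^sub>C ad (L 0) y) | (a\<^sub>0 :: complex) (x :: witt). x \<in> L1}"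
    (is "_ = ?R")
proof
  show "?R \<subseteq> carrier Aut"
    by (auto simp: Aut_def
        intro!: lie_automorphism_comp lie_automorphism_exp_ad lie_automorphism_exp_ad_L0)
  show "carrier Aut \<subseteq> ?R"
  proof
    fix f assume "f \<in> carrier Aut"
    then have f: "lie_automorphism f" by (simp add: Aut_def)
    define c where "c = coeff (f (L (-1))) (-1)"
    have c: "c \<noteq> 0"
      unfolding c_def lie_automorphism_hyperplane[OF f] by (simp add: L.rep_eq)
    then obtain x where x: "x \<in> L1" and exp_x: "exp_op (ad x) (L (-1)) = (1 / c) *\<^sub>C f (L (-1))"
      using exp_ad_transitive[of "(1 / c) *\<^sub>C f (L (-1))"] by (auto simp: coeff_simps c_def)
    \<comment> \<open>The scaling acts on degree \<open>-1\<close> by \<open>exp (- a)\<close>.\<close>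
    define a where "a = - Complex (ln (cmod c)) (Arg c)"
    have a: "exp (- a) = c"
      using c rcis_cmod_Arg[of c] by (simp add: a_def exp_eq_polar rcis_def)
    define g where "g = exp_op (ad x) \<circ> exp_op (\<lambda>y. a *\<^sub>C ad (L 0) y)"
    have g: "lie_automorphism g"
      unfolding g_def
      by (intro lie_automorphism_comp lie_automorphism_exp_ad lie_automorphism_exp_ad_L0 x)
    have "exp_op (\<lambda>y. a *\<^sub>C ad (L 0) y) (L (-1)) = c *\<^sub>C L (-1)"
      by (rule witt_eqI) (use c in \<open>auto simp: coeff_exp_ad_L0 coeff_simps L.rep_eq a\<close>)
    moreover have "exp_op (ad x) (c *\<^sub>C L (-1)) = c *\<^sub>C exp_op (ad x) (L (-1))"
      using linear_exp_ad[OF x] by (simp add: Vector_Spaces.linear_iff)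
    ultimately have gL: "g (L (-1)) = f (L (-1))"
      using c by (simp add: g_def exp_x)
    have "bij g" using g by (simp add: lie_automorphism_def)
    then have inv_g: "inv_into UNIV g (g y) = y" "g (inv_into UNIV g y) = y" for y
      by (simp_all add: bij_is_inj bij_is_surj surj_f_inv_f)
    have "lie_automorphism (inv_into UNIV g \<circ> f)"
      by (intro lie_automorphism_comp lie_automorphism_inv f g)
    moreover have "(inv_into UNIV g \<circ> f) (L (-1)) = L (-1)"
      by (simp add: gL[symmetric] inv_g)
    ultimately have "inv_into UNIV g (f y) = y" for y
      using automorphism_fixing_L_minus_1 by fastforce
    then have "f = g"
      by (metis ext inv_g(2))
    then show "f \<in> ?R"
      using x unfolding g_def by blast
  qed
qed

end
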